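(* For all connected graphs $G$ and $H$ on $n$ vertices, either $X_G-X_H=0$ or $X_G-X_H$ is not $e$-positive.
   Context: All graphs are finite and simple. The chromatic symmetric function of a graph $G$ with vertices $v_1,\dots,v_n$ is $X_G=\sum_{\kappa}x_{\kappa(v_1)}\cdots x_{\kappa(v_n)}$, summed over all proper colorings $\kappa:V(G)\to\{1,2,3,\dots\}$ (adjacent vertices get different colors); it is a homogeneous symmetric function of degree $n$ in commuting variables $x_1,x_2,\dots$ over $\mathbb{Q}$. A symmetric function is $e$-positive if it is a linear combination of the elementary symmetric functions $e_\lambda=e_{\lambda_1}e_{\lambda_2}\cdots$ ($\lambda$ an integer partition) with non-negative coefficients. *)

theory Defs
  imports "HOL-Library.Multiset" "HOL-Library.FuncSet" "Graph_Theory.Graph_Theory"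
begin

section \<open>Formal power series in countably many commuting variables\<close>

text \<open>
  A monomial in the variables $x_0, x_1, x_2, \dots$ is the finite multiset of the indices occurring
  in it, so that multiplication of monomials is addition of multisets.  A power series maps every
  monomial to its coefficient.  Numbering the variables (and the colours below) from 0
  instead of 1 is only a matter of labelling.
\<close>

typedef 'a mfps = "UNIV :: (nat multiset \<Rightarrow> 'a) set"
  morphisms mfps_coeff Abs_mfps ..

lemma mfps_coeff_Abs [simp]: "mfps_coeff (Abs_mfps f) = f"
  by (simp add: Abs_mfps_inverse)

lemma mfps_eq_iff: "f = g \<longleftrightarrow> (\<forall>M. mfps_coeff f M = mfps_coeff g M)"
  by (metis mfps_coeff_inject ext)

lemma finite_mset_splits: "finite {(A, B). A + B = (M :: 'b multiset)}"
proof -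
  let ?S = "mset ` {xs. set xs \<subseteq> set_mset M \<and> length xs \<le> size M}"
  have mem: "A \<in> ?S" if "A \<subseteq># M" for A
  proof -
    obtain xs where "mset xs = A"
      using ex_mset by blast
    then show ?thesis
      using that set_mset_mono size_mset_mono by (intro image_eqI[of _ _ xs]) force+
  qed
  have "finite ?S"
    by (intro finite_imageI finite_lists_length_le) auto
  moreover have "{(A, B). A + B = M} \<subseteq> ?S \<times> ?S"
    using mem by auto
  ultimately show ?thesis
    by (meson finite_SigmaI finite_subset)
qed

instantiation mfps :: (comm_ring_1) comm_ring_1
begin

definition "0 = Abs_mfps (\<lambda>M. 0)"
definition "1 = Abs_mfps (\<lambda>M. if M = {#} then 1 else 0)"
definition "f + g = Abs_mfps (\<lambda>M. mfps_coeff f M + mfps_coeff g M)"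
definition "f - g = Abs_mfps (\<lambda>M. mfps_coeff f M - mfps_coeff g M)"
definition "- f = Abs_mfps (\<lambda>M. - mfps_coeff f M)"
definition "f * g =
  Abs_mfps (\<lambda>M. \<Sum>(A, B)\<in>{(A, B). A + B = M}. mfps_coeff f A * mfps_coeff g B)"

instance
proof
  fix f g h :: "'a mfps"
  show "f * g * h = f * (g * h)"
  proof (unfold mfps_eq_iff, intro allI)
    fix M
    let ?t = "\<lambda>A B C. mfps_coeff f A * mfps_coeff g B * mfps_coeff h C"
    have "mfps_coeff (f * g * h) M =
        (\<Sum>(D, C)\<in>{(D, C). D + C = M}. \<Sum>(A, B)\<in>{(A, B). A + B = D}. ?t A B C)"
      by (simp add: times_mfps_def sum_distrib_right case_prod_beta)
    also have "\<dots> = (\<Sum>((D, C), A, B)\<in>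
        (SIGMA p:{(D, C). D + C = M}. {(A, B). A + B = fst p}). ?t A B C)"
      by (subst sum.Sigma[symmetric]) (auto simp: finite_mset_splits case_prod_beta)
    also have "\<dots> = (\<Sum>((A, E), B, C)\<in>
        (SIGMA p:{(A, E). A + E = M}. {(B, C). B + C = snd p}). ?t A B C)"
      by (rule sum.reindex_bij_witness[of _
            "\<lambda>((A, E), B, C). ((A + B, C), A, B)" "\<lambda>((D, C), A, B). ((A, B + C), B, C)"])
        (auto simp: add.assoc)
    also have "\<dots> = (\<Sum>(A, E)\<in>{(A, E). A + E = M}. \<Sum>(B, C)\<in>{(B, C). B + C = E}. ?t A B C)"
      by (subst sum.Sigma[symmetric]) (auto simp: finite_mset_splits case_prod_beta)
    also have "\<dots> = mfps_coeff (f * (g * h)) M"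
      by (simp add: times_mfps_def sum_distrib_left case_prod_beta mult.assoc)
    finally show "mfps_coeff (f * g * h) M = mfps_coeff (f * (g * h)) M" .
  qed
  show "f * g = g * f"
    unfolding mfps_eq_iff times_mfps_def mfps_coeff_Abs
    by (intro allI sum.reindex_bij_witness[of _ prod.swap prod.swap])
      (auto simp: add.commute mult.commute)
  show "1 * f = f"
  proof (unfold mfps_eq_iff, intro allI)
    fix M
    have "mfps_coeff (1 * f) M = (\<Sum>(A, B)\<in>{({#} :: nat multiset, M)}. mfps_coeff f B)"
      unfolding times_mfps_def one_mfps_def mfps_coeff_Abs
      by (rule sum.mono_neutral_cong_right) (auto simp: finite_mset_splits split: if_splits)
    then show "mfps_coeff (1 * f) M = mfps_coeff f M"
      by simp
  qed
  show "(f + g) * h = f * h + g * h"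
    by (simp add: mfps_eq_iff times_mfps_def plus_mfps_def distrib_right sum.distrib case_prod_beta)
  show "(0 :: 'a mfps) \<noteq> 1"
    by (auto simp: mfps_eq_iff zero_mfps_def one_mfps_def intro: exI[of _ "{#}"])
qed (simp_all add: mfps_eq_iff zero_mfps_def plus_mfps_def minus_mfps_def uminus_mfps_def
      algebra_simps)

end

definition mfps_const :: "'a \<Rightarrow> 'a :: comm_ring_1 mfps" where
  "mfps_const c = Abs_mfps (\<lambda>M. if M = {#} then c else 0)"


section \<open>Elementary symmetric functions and e-positivity\<close>

text \<open>
  $e_k$ is the sum of all products of $k$ distinct variables; in particular $e_0 = 1$.
\<close>

definition elem_sym :: "nat \<Rightarrow> rat mfps" where
  "elem_sym k = Abs_mfps (\<lambda>M. if \<exists>S. finite S \<and> card S = k \<and> M = mset_set S then 1 else 0)"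

text \<open>Integer partitions are multisets of positive parts (of any size).\<close>

definition partitions :: "nat multiset set" where
  "partitions = {p. 0 \<notin># p}"

definition elem_sym_partition :: "nat multiset \<Rightarrow> rat mfps" where
  "elem_sym_partition p = (\<Prod>k\<in>#p. elem_sym k)"

definition e_positive :: "rat mfps \<Rightarrow> bool" where
  "e_positive f \<longleftrightarrow> (\<exists>P c. finite P \<and> P \<subseteq> partitions \<and> (\<forall>p\<in>P. c p \<ge> 0) \<and>
     f = (\<Sum>p\<in>P. mfps_const (c p) * elem_sym_partition p))"


section \<open>Chromatic symmetric functions\<close>

text \<open>
  A simple graph is a \<open>pair_graph\<close>, that is, a finite vertex set with a symmetric irreflexive set of
  arcs.  Colourings are extensional (undefined off the vertex set), so that they can be counted.
\<close>

definition proper_colorings :: "'v pair_pre_digraph \<Rightarrow> ('v \<Rightarrow> nat) set" where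
  "proper_colorings G =
     {\<kappa> \<in> pverts G \<rightarrow>\<^sub>E UNIV. \<forall>(u, v)\<in>parcs G. \<kappa> u \<noteq> \<kappa> v}"

text \<open>
  The sum over all proper colourings is infinite, but every monomial arises from only finitely many
  of them; its coefficient is their number.
\<close>

definition coloring_monomial :: "'v pair_pre_digraph \<Rightarrow> ('v \<Rightarrow> nat) \<Rightarrow> nat multiset" where
  "coloring_monomial G \<kappa> = image_mset \<kappa> (mset_set (pverts G))"

lemma finite_colorings_of_monomial:
  assumes "finite (pverts G)"
  shows "finite {\<kappa> \<in> proper_colorings G. coloring_monomial G \<kappa> = M}"
proof (rule finite_subset)
  show "{\<kappa> \<in> proper_colorings G. coloring_monomial G \<kappa> = M} \<subseteq> pverts G \<rightarrow>\<^sub>E set_mset M"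
    using assms by (auto simp: proper_colorings_def coloring_monomial_def PiE_iff
        extensional_def)
  show "finite (pverts G \<rightarrow>\<^sub>E set_mset M)"
    using assms by (intro finite_PiE) auto
qed

definition chromatic_sym :: "'v pair_pre_digraph \<Rightarrow> rat mfps" where
  "chromatic_sym G =
     Abs_mfps (\<lambda>M. of_nat (card {\<kappa> \<in> proper_colorings G. coloring_monomial G \<kappa> = M}))"

end

theory Submission
  imports Defs
begin

text \<open>
  Every proper colouring with pairwise distinct colours is just an injection, so the coefficient of
  a squarefree monomial in a chromatic symmetric function depends only on the number of vertices and
  cancels in the difference.  On the other hand, the coefficient of a squarefree monomial of degree
  $m$ in $e_\lambda$ is positive whenever $\lambda$ is a partition of $m$.  Hence all coefficients
  of a non-negative $e$-expansion of the difference vanish.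
\<close>

lemma mfps_coeff_mult:
  "mfps_coeff (f * g) M = (\<Sum>(A, B)\<in>{(A, B). A + B = M}. mfps_coeff f A * mfps_coeff g B)"
  by (simp add: times_mfps_def)

lemma mfps_coeff_sum: "mfps_coeff (\<Sum>i\<in>I. f i) M = (\<Sum>i\<in>I. mfps_coeff (f i) M)"
  by (induction I rule: infinite_finite_induct) (simp_all add: zero_mfps_def plus_mfps_def)

lemma mfps_coeff_const_mult: "mfps_coeff (mfps_const c * f) M = c * mfps_coeff f M"
proof -
  have "mfps_coeff (mfps_const c * f) M =
      (\<Sum>(A, B)\<in>{({#} :: nat multiset, M)}. c * mfps_coeff f B)"
    unfolding mfps_coeff_mult mfps_const_def mfps_coeff_Abs
    by (rule sum.mono_neutral_cong_right) (auto simp: finite_mset_splits split: if_splits)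
  then show ?thesis
    by simp
qed

lemma mfps_coeff_mult_nonneg:
  fixes f g :: "'a :: linordered_idom mfps"
  assumes "\<And>M. mfps_coeff f M \<ge> 0" "\<And>M. mfps_coeff g M \<ge> 0"
  shows "mfps_coeff (f * g) M \<ge> 0"
  unfolding mfps_coeff_mult using assms by (auto intro!: sum_nonneg)

text \<open>The split \<open>(A, B)\<close> contributes a positive summand, and non-negativity of
  all other splits rules out cancellation.\<close>

lemma mfps_coeff_mult_pos:
  fixes f g :: "'a :: linordered_idom mfps"
  assumes "\<And>M. mfps_coeff f M \<ge> 0" "\<And>M. mfps_coeff g M \<ge> 0"
    and "mfps_coeff f A > 0" "mfps_coeff g B > 0"
  shows "mfps_coeff (f * g) (A + B) > 0"
  unfolding mfps_coeff_mult using assms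
  by (intro sum_pos2[where i = "(A, B)"]) (auto simp: finite_mset_splits)

lemma elem_sym_nonneg: "mfps_coeff (elem_sym k) M \<ge> 0"
  by (simp add: elem_sym_def)

lemma elem_sym_partition_nonneg: "mfps_coeff (elem_sym_partition p) M \<ge> 0"
proof (induction p arbitrary: M)
  case empty
  then show ?case
    by (simp add: elem_sym_partition_def one_mfps_def)
next
  case (add k p)
  then show ?case
    using mfps_coeff_mult_nonneg[OF elem_sym_nonneg] by (simp add: elem_sym_partition_def)
qed

text \<open>Induction on the parts: a part \<open>k\<close> takes a \<open>k\<close>-element subset
  \<open>T\<close> of \<open>S\<close>, whose monomial occurs in \<open>elem_sym k\<close>, and the
  remaining parts are served by \<open>S - T\<close>.\<close>

lemma elem_sym_partition_squarefree_pos: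
  assumes "finite S" "card S = \<Sum>\<^sub># p"
  shows "mfps_coeff (elem_sym_partition p) (mset_set S) > 0"
  using assms
proof (induction p arbitrary: S)
  case empty
  then show ?case
    by (simp add: elem_sym_partition_def one_mfps_def)
next
  case (add k p)
  then obtain T where T: "T \<subseteq> S" "card T = k"
    by (metis le_add1 obtain_subset_with_card_n sum_mset.add_mset)
  have fin: "finite T"
    using T add.prems(1) finite_subset by blast
  have "card (S - T) = \<Sum>\<^sub># p"
    using add.prems T fin by (simp add: card_Diff_subset)
  then have "mfps_coeff (elem_sym_partition p) (mset_set (S - T)) > 0"
    using add by simp
  moreover have "mfps_coeff (elem_sym k) (mset_set T) > 0"
    using T fin by (auto simp: elem_sym_def)
  ultimately have "mfps_coeff (elem_sym k * elem_sym_partition p)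
      (mset_set T + mset_set (S - T)) > 0"
    by (intro mfps_coeff_mult_pos elem_sym_nonneg elem_sym_partition_nonneg)
  moreover have "mset_set T + mset_set (S - T) = mset_set S"
    using T add.prems(1) by (simp add: mset_set_Diff subset_imp_msubset_mset_set)
  ultimately show ?case
    by (simp add: elem_sym_partition_def)
qed

text \<open>Comparing supports gives surjectivity; comparing sizes then gives injectivity.\<close>

lemma image_mset_eq_mset_set_iff_bij_betw:
  assumes "finite A" "finite B"
  shows "image_mset f (mset_set A) = mset_set B \<longleftrightarrow> bij_betw f A B"
proof
  assume eq: "image_mset f (mset_set A) = mset_set B"
  have "f ` A = B"
    using arg_cong[OF eq, of set_mset] assms by simp
  moreover have "card A = card B"
    using arg_cong[OF eq, of size] assms by simp
  ultimately show "bij_betw f A B"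
    using assms by (simp add: bij_betw_def eq_card_imp_inj_on)
next
  assume "bij_betw f A B"
  then show "image_mset f (mset_set A) = mset_set B"
    by (auto simp: bij_betw_def image_mset_mset_set)
qed

text \<open>The colourings with this monomial are exactly the bijections from the vertices onto
  \<open>S\<close>, whatever the arcs are.\<close>

lemma chromatic_sym_squarefree:
  assumes "pair_graph G" "finite S"
  shows "mfps_coeff (chromatic_sym G) (mset_set S) =
    (if card S = card (pverts G) then fact (card S) else 0)"
proof -
  interpret pair_graph G by fact
  let ?V = "pverts G"
  let ?K = "{\<kappa> \<in> proper_colorings G. coloring_monomial G \<kappa> = mset_set S}"
  \<comment> \<open>Without loops, the two ends of an arc are distinct vertices, which an injection
    separates.\<close>
  have proper: "\<kappa> \<in> proper_colorings G" if "\<kappa> \<in> ?V \<rightarrow>\<^sub>E UNIV" "inj_on \<kappa> ?V" for \<kappa>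
    using that by (auto simp: proper_colorings_def) (metis inj_onD in_arcsD1 in_arcsD2 no_loops')
  have K: "?K = {\<kappa> \<in> ?V \<rightarrow>\<^sub>E UNIV. bij_betw \<kappa> ?V S}"
    unfolding coloring_monomial_def image_mset_eq_mset_set_iff_bij_betw[OF pair_finite_verts assms(2)]
    using proper by (auto simp: bij_betw_def proper_colorings_def)
  show ?thesis
  proof (cases "card S = card ?V")
    case True
    \<comment> \<open>Equal cardinalities make every injection into \<open>S\<close> onto, so
      counting bijections reduces to counting injections.\<close>
    have "\<kappa> ` ?V = S" if "\<kappa> \<in> ?V \<rightarrow>\<^sub>E S" "inj_on \<kappa> ?V" for \<kappa>
      using that True assms(2) by (intro card_subset_eq) (auto simp: card_image)
    then have "?K = {\<kappa> \<in> ?V \<rightarrow>\<^sub>E S. inj_on \<kappa> ?V}"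
      unfolding K by (auto simp: bij_betw_def PiE_iff)
    moreover have "card {\<kappa> \<in> ?V \<rightarrow>\<^sub>E S. inj_on \<kappa> ?V} = fact (card S)"
      \<comment> \<open>Injectivity is required on the whole domain, so the power of
        \<open>card S\<close> in the library formula has exponent 0; the remaining falling product
        is a factorial.\<close>
      using card_inj_on_subset_funcset[of ?V S ?V] True assms(2) by (simp add: fact_prod_rev)
    ultimately show ?thesis
      using True by (simp add: chromatic_sym_def)
  next
    case False
    then have "?K = {}"
      unfolding K by (auto dest: bij_betw_same_card)
    then have "card ?K = 0"
      by (simp only: card.empty)
    then show ?thesis
      using False by (simp add: chromatic_sym_def)
  qed
qed

theorem theorem2p16:
  fixes G :: "'v pair_pre_digraph" and H :: "'w pair_pre_digraph" and n :: nat
  assumes "pair_graph G" "connected (with_proj G)" "card (pverts G) = n"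
    and "pair_graph H" "connected (with_proj H)" "card (pverts H) = n"
  shows "chromatic_sym G - chromatic_sym H = 0 \<or> \<not> e_positive (chromatic_sym G - chromatic_sym H)"
proof -
  let ?D = "chromatic_sym G - chromatic_sym H"
  have "?D = 0" if pos: "e_positive ?D"
  proof -
    obtain P c where P: "finite P" "\<And>p. p \<in> P \<Longrightarrow> c p \<ge> 0"
      and D: "?D = (\<Sum>p\<in>P. mfps_const (c p) * elem_sym_partition p)"
      using pos unfolding e_positive_def by blast
    have "c p = 0" if p: "p \<in> P" for p
    proof -
      \<comment> \<open>A squarefree monomial of the degree of \<open>p\<close>, chosen so that the
        term of \<open>p\<close> has a positive coefficient there.\<close>
      let ?M = "mset_set {..<\<Sum>\<^sub># p}"
      \<comment> \<open>Both graphs have \<open>n\<close> vertices: the two coefficients are both n!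
        if \<open>p\<close> is a partition of \<open>n\<close>, and both 0 otherwise.\<close>
      have "0 = mfps_coeff ?D ?M"
        using assms by (simp add: minus_mfps_def chromatic_sym_squarefree)
      also have "\<dots> = (\<Sum>q\<in>P. c q * mfps_coeff (elem_sym_partition q) ?M)"
        by (simp add: D mfps_coeff_sum mfps_coeff_const_mult)
      \<comment> \<open>A vanishing sum of non-negative terms has only zero terms.\<close>
      finally have "c p * mfps_coeff (elem_sym_partition p) ?M = 0"
        using P p by (simp add: sum_nonneg_eq_0_iff elem_sym_partition_nonneg)
      then show ?thesis
        using elem_sym_partition_squarefree_pos[of "{..<\<Sum>\<^sub># p}" p] by simp
    qed
    then show ?thesis
      by (simp add: D mfps_eq_iff mfps_coeff_sum mfps_coeff_const_mult zero_mfps_def)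
  qed
  then show ?thesis
    by blast
qed

end
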